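(* Let $P$ be a $d$-dimensional Forman--Ricci-positive polytope and let $\rho$ be the average vertex degree of the graph of $P$. Then the number $n$ of vertices of $P$ satisfies $$n\leq\frac{2^{3\rho+1}\rho\,(2^{3\rho+1}\rho-1)^{4+6\rho}-2}{2^{3\rho}\rho-1}.$$
   Context: For an edge $e$ of a polytope $P$, $\mathcal{F}\uparrow(e)$ is the set of $2$-faces containing $e$; two distinct edges are parallel neighbors if either they share a vertex but lie in no common $2$-face, or they are vertex-disjoint but lie in a common $2$-face; $\mathcal{E}(e)$ is the set of parallel neighbors of $e$; the Forman--Ricci curvature is $\mathcal{F}(e)=|\mathcal{F}\uparrow(e)|+2-|\mathcal{E}(e)|$. $P$ is Forman--Ricci-positive if $\mathcal{F}(e)>0$ for all edges $e$. *)

theory Defs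
  imports "HOL-Analysis.Analysis"
begin

definition vertices :: "'a::euclidean_space set \<Rightarrow> 'a set" where
  "vertices P = {v. v extreme_point_of P}"

definition edges :: "'a::euclidean_space set \<Rightarrow> 'a set set" where
  "edges P = {e. e edge_of P}"

definition two_faces :: "'a::euclidean_space set \<Rightarrow> 'a set set" where
  "two_faces P = {F. F face_of P \<and> aff_dim F = 2}"

text \<open>Faces are not required to be proper: a 2-dimensional polytope is its own unique 2-face.\<close>

definition faces_up :: "'a::euclidean_space set \<Rightarrow> 'a set \<Rightarrow> 'a set set" where
  "faces_up P e = {F \<in> two_faces P. e \<subseteq> F}"

definition share_vertex :: "'a::euclidean_space set \<Rightarrow> 'a set \<Rightarrow> 'a set \<Rightarrow> bool" where
  "share_vertex P e f \<longleftrightarrow> (\<exists>v \<in> vertices P. v \<in> e \<and> v \<in> f)"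

definition in_common_two_face :: "'a::euclidean_space set \<Rightarrow> 'a set \<Rightarrow> 'a set \<Rightarrow> bool" where
  "in_common_two_face P e f \<longleftrightarrow> (\<exists>F \<in> two_faces P. e \<subseteq> F \<and> f \<subseteq> F)"

definition parallel_neighbors :: "'a::euclidean_space set \<Rightarrow> 'a set \<Rightarrow> 'a set set" where
  "parallel_neighbors P e =
     {f \<in> edges P. f \<noteq> e \<and>
        (share_vertex P e f \<and> \<not> in_common_two_face P e f \<or>
         \<not> share_vertex P e f \<and> in_common_two_face P e f)}"

definition forman_ricci :: "'a::euclidean_space set \<Rightarrow> 'a set \<Rightarrow> int" where
  "forman_ricci P e = int (card (faces_up P e)) + 2 - int (card (parallel_neighbors P e))"

definition forman_ricci_positive :: "'a::euclidean_space set \<Rightarrow> bool" where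
  "forman_ricci_positive P \<longleftrightarrow> (\<forall>e \<in> edges P. forman_ricci P e > 0)"

definition vertex_degree :: "'a::euclidean_space set \<Rightarrow> 'a \<Rightarrow> nat" where
  "vertex_degree P v = card {e \<in> edges P. v \<in> e}"

definition average_degree :: "'a::euclidean_space set \<Rightarrow> real" where
  "average_degree P = (\<Sum>v \<in> vertices P. real (vertex_degree P v)) / real (card (vertices P))"

end

theory Submission
  imports Defs
begin

text \<open>
  Let \<open>\<phi>\<close> be the graph distance from a vertex \<open>a\<close>, and let \<open>\<Delta>\<phi>(v)\<close> be the sum of
  \<open>\<phi>(w) - \<phi>(v)\<close> over the neighbours \<open>w\<close> of \<open>v\<close>. Consider an edge \<open>uv\<close> with
  \<open>\<phi>(v) = \<phi>(u) + 1\<close>. In a 2-face containing \<open>uv\<close>, with further edges \<open>uw\<close> and \<open>vw'\<close>, the part of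
  the boundary from \<open>w\<close> to \<open>w'\<close> avoiding \<open>uv\<close> has at least \<open>\<phi>(w') - \<phi>(w)\<close> edges, and these are
  parallel neighbours of \<open>uv\<close>. Summing over the 2-faces, positivity of the curvature gives
  \<open>\<Delta>\<phi>(v) \<le> \<Delta>\<phi>(u) - 1\<close>. Since \<open>\<bar>\<Delta>\<phi>\<bar>\<close> is bounded by the degree at both ends, any two vertices are
  at distance at most the sum of their degrees. Positivity also forces the degrees of adjacent
  vertices to be within a factor 2 of each other.

  By Markov's inequality at least half of the vertices have degree at most \<open>2\<rho>\<close>. They are joined by
  geodesics of length at most \<open>4\<rho>\<close>, on which all degrees are at most \<open>2\<^sup>2\<^sup>\<rho> \<cdot> 2\<rho>\<close>, so counting walks
  bounds their number.
\<close>

subsection \<open>Edges and neighbours in a polytope\<close>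

definition adj :: "'a::euclidean_space set \<Rightarrow> 'a \<Rightarrow> 'a \<Rightarrow> bool" where
  "adj P v w \<longleftrightarrow> closed_segment v w edge_of P"

lemma polytope_face_exposed:
  fixes P :: "'a::euclidean_space set"
  assumes "polytope P" "F face_of P"
  obtains a b where "\<And>x. x \<in> P \<Longrightarrow> a \<bullet> x \<le> b" "F = P \<inter> {x. a \<bullet> x = b}"
proof -
  have "F exposed_face_of P"
    using assms by (simp add: exposed_face_of_polyhedron polytope_imp_polyhedron)
  then show thesis
    using that unfolding exposed_face_of_def by blast
qed

lemma polytope_eq_hull_vertices:
  fixes P :: "'a::euclidean_space set"
  assumes "polytope P"
  shows "P = convex hull vertices P"
  unfolding vertices_def
  using assms by (simp add: Krein_Milman_Minkowski polytope_imp_compact polytope_imp_convex)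

lemma vertices_subset: "vertices P \<subseteq> P"
  by (auto simp: vertices_def extreme_point_of_def)

lemma vertices_face: "F face_of P \<Longrightarrow> vertices F = vertices P \<inter> F"
  by (auto simp: vertices_def extreme_point_of_face)

lemma finite_vertices:
  fixes P :: "'a::euclidean_space set"
  assumes "polytope P"
  shows "finite (vertices P)"
  using assms by (simp add: vertices_def finite_polyhedron_extreme_points polytope_imp_polyhedron)

lemma polytope_less_if_vertices_less:
  fixes P :: "'a::euclidean_space set"
  assumes "polytope P" "\<And>v. v \<in> vertices P \<Longrightarrow> a \<bullet> v < b" "x \<in> P"
  shows "a \<bullet> x < b"
proof -
  have "convex hull vertices P \<subseteq> {x. a \<bullet> x < b}"
    using assms(2) by (intro hull_minimal) (auto simp: convex_halfspace_lt)
  then show ?thesis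
    using assms polytope_eq_hull_vertices by blast
qed

lemma polytope_le_if_vertices_le:
  fixes P :: "'a::euclidean_space set"
  assumes "polytope P" "\<And>v. v \<in> vertices P \<Longrightarrow> a \<bullet> v \<le> b" "x \<in> P"
  shows "a \<bullet> x \<le> b"
proof -
  have "convex hull vertices P \<subseteq> {x. a \<bullet> x \<le> b}"
    using assms(2) by (intro hull_minimal) (auto simp: convex_halfspace_le)
  then show ?thesis
    using assms polytope_eq_hull_vertices by blast
qed

lemma adj_neq: "adj P v w \<Longrightarrow> v \<noteq> w"
  by (auto simp: adj_def edge_of_def)

lemma adj_sym: "adj P v w \<Longrightarrow> adj P w v"
  by (simp add: adj_def closed_segment_commute)

lemma adj_vertex: "adj P v w \<Longrightarrow> v \<in> vertices P"
  using extreme_point_of_face[of "closed_segment v w" P v]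
  by (auto simp: adj_def vertices_def edge_of_def extreme_point_of_segment)

lemma adj_vertex2: "adj P v w \<Longrightarrow> w \<in> vertices P"
  using adj_sym adj_vertex by blast

lemma vertices_segment: "vertices (closed_segment v w) = {v, w}"
  by (auto simp: vertices_def extreme_point_of_segment)

lemma edge_face: "e \<in> edges P \<Longrightarrow> e face_of P"
  by (simp add: edges_def edge_of_def)

lemma adj_edge: "adj P v w \<Longrightarrow> closed_segment v w \<in> edges P"
  by (simp add: adj_def edges_def)

lemma adj_face: "F face_of P \<Longrightarrow> adj F v w \<longleftrightarrow> adj P v w \<and> closed_segment v w \<subseteq> F"
  by (auto simp: adj_def edge_of_def face_of_face)

lemma adj_face_iff: "F face_of P \<Longrightarrow> adj F v w \<longleftrightarrow> adj P v w \<and> v \<in> F \<and> w \<in> F"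
  unfolding adj_face using closed_segment_subset ends_in_segment face_of_imp_convex by (metis in_mono)

lemma edge_eq_segment:
  fixes P :: "'a::euclidean_space set"
  assumes "polytope P" "e \<in> edges P"
  obtains v w where "e = closed_segment v w" "adj P v w"
proof -
  have e: "e face_of P" "aff_dim e = 1"
    using assms by (auto simp: edges_def edge_of_def)
  then have "polytope e"
    using assms face_of_polytope_polytope by blast
  moreover have "e \<noteq> {}" "collinear e"
    using e by (auto simp: collinear_aff_dim)
  ultimately obtain v w where "e = closed_segment v w"
    by (metis compact_convex_collinear_segment polytope_imp_compact polytope_imp_convex)
  then show thesis
    using that e by (simp add: adj_def edge_of_def)
qed

lemma edge_eq_segment_at:
  fixes P :: "'a::euclidean_space set"
  assumes "polytope P" "e \<in> edges P" "v \<in> vertices P" "v \<in> e"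
  obtains w where "e = closed_segment v w" "adj P v w"
proof -
  obtain a b where ab: "e = closed_segment a b" "adj P a b"
    using assms edge_eq_segment by blast
  have "v \<in> vertices e"
    using assms edge_face vertices_face by blast
  then have "v = a \<or> v = b"
    using ab vertices_segment by blast
  then show thesis
    using that ab adj_sym closed_segment_commute by metis
qed

text \<open>The smallest face \<open>G\<close> through \<open>q\<close> has \<open>q\<close> in its
  relative interior. If its dimension were at least 2, the hyperplane would meet its affine hull in
  at least a line through \<open>q\<close>, so \<open>q\<close> could move both ways inside the
  section and would not be extreme.\<close>

lemma extreme_point_of_hyperplane_section:
  fixes P :: "'a::euclidean_space set"
  assumes P: "polytope P" and q: "q extreme_point_of (P \<inter> {x. a \<bullet> x = b})"
  obtains G where "G face_of P" "q \<in> G" "aff_dim G \<le> 1"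
proof -
  have qP: "q \<in> P" "a \<bullet> q = b"
    using q by (auto simp: extreme_point_of_def)
  let ?C = "{F. F face_of P \<and> q \<in> F}"
  have "P \<in> ?C"
    using P qP by (simp add: face_of_refl polytope_imp_convex)
  \<comment> \<open>The shift by 1 keeps the measure faithful down to the empty face, whose
    \<open>aff_dim\<close> is -1.\<close>
  then obtain G where G: "G face_of P" "q \<in> G"
    and Gmin: "\<And>F. F face_of P \<Longrightarrow> q \<in> F \<Longrightarrow> nat (aff_dim G + 1) \<le> nat (aff_dim F + 1)"
    using ex_has_least_nat[of "\<lambda>F. F \<in> ?C" P "\<lambda>F. nat (aff_dim F + 1)"] by auto
  have pG: "polytope G"
    using G P face_of_polytope_polytope by blast
  have qri: "q \<in> rel_interior G"
  proof (rule ccontr)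
    assume "q \<notin> rel_interior G"
    then have "q \<in> G - rel_interior G" using G by blast
    then obtain F where F: "F face_of G" "F \<noteq> G" "q \<in> F"
      using rel_boundary_of_polyhedron[OF polytope_imp_polyhedron[OF pG]]
      by (metis UnionE facet_of_imp_face_of facet_of_irrefl mem_Collect_eq)
    then have "aff_dim F < aff_dim G"
      using pG face_of_aff_dim_lt polytope_imp_convex by blast
    moreover have "nat (aff_dim G + 1) \<le> nat (aff_dim F + 1)"
      using Gmin F G face_of_trans by blast
    ultimately show False
      using aff_dim_geq[of F] by linarith
  qed
  have "aff_dim G \<le> 1"
  proof (rule ccontr)
    assume "\<not> aff_dim G \<le> 1"
    then have "aff_dim (affine hull G) \<ge> 2" by simp
    moreover have "q \<in> affine hull G \<inter> {x. a \<bullet> x = b}"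
      using G qP by (auto simp: hull_inc)
    ultimately have "aff_dim (affine hull G \<inter> {x. a \<bullet> x = b}) \<ge> 1"
      using aff_dim_affine_Int_hyperplane[of "affine hull G" a b] by (auto split: if_splits)
    then have "\<not> affine hull G \<inter> {x. a \<bullet> x = b} \<subseteq> {q}"
      using aff_dim_subset[of "affine hull G \<inter> {x. a \<bullet> x = b}" "{q}"] by auto
    then obtain y where y: "y \<in> affine hull G" "a \<bullet> y = b" "y \<noteq> q"
      by blast
    obtain e where e: "e > 0" "cball q e \<inter> affine hull G \<subseteq> G"
      using qri by (auto simp: mem_rel_interior_cball)
    \<comment> \<open>This scaling gives \<open>u\<close> the length \<open>e\<close> of the radius,
      so \<open>q + u\<close> and \<open>q - u\<close> both stay in \<open>G\<close>.\<close>
    define t where "t = e / norm (y - q)"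
    have t: "t > 0" using e y by (simp add: t_def)
    define u where "u = t *\<^sub>R (y - q)"
    have u: "norm u = e" "u \<noteq> 0" "a \<bullet> u = 0"
      using e y qP t by (auto simp: u_def t_def inner_diff_right)
    have "q + u = (1 - t) *\<^sub>R q + t *\<^sub>R y" "q - u = (1 + t) *\<^sub>R q + (-t) *\<^sub>R y"
      by (auto simp: u_def algebra_simps)
    then have "q + u \<in> affine hull G" "q - u \<in> affine hull G"
      using mem_affine[OF affine_affine_hull, of q G y "1 - t" t]
        mem_affine[OF affine_affine_hull, of q G y "1 + t" "- t"] y G
      by (auto simp: hull_inc)
    then have "q + u \<in> G" "q - u \<in> G"
      using e u by (auto simp: dist_norm)
    then have "q + u \<in> P \<inter> {x. a \<bullet> x = b}" "q - u \<in> P \<inter> {x. a \<bullet> x = b}"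
      using G face_of_imp_subset u qP by (auto simp: inner_diff_right inner_add_right)
    moreover have "q \<in> open_segment (q + u) (q - u)"
    proof -
      have "q = midpoint (q + u) (q - u)"
        by (simp add: midpoint_def scaleR_2 flip: scaleR_2)
      moreover have "q + u \<noteq> q - u" 
        using u by (metis add_diff_cancel_left' add_eq_0_iff2 diff_conv_add_uminus eq_neg_iff_add_eq_0 scaleR_2 scaleR_eq_0_iff zero_neq_numeral add_left_cancel)
      ultimately show ?thesis
        by (metis midpoint_in_open_segment)
    qed
    ultimately show False
      using q by (auto simp: extreme_point_of_def)
  qed
  then show thesis using that G by blast
qed

text \<open>Cut off \<open>v\<close> by a hyperplane: the vertices of the section (the vertex figure) lie on the edges at
  \<open>v\<close>, and by Krein--Milman one of them improves \<open>c\<close>.\<close>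

lemma improving_neighbour:
  fixes P :: "'a::euclidean_space set"
  assumes P: "polytope P" and v: "v \<in> vertices P" and x: "x \<in> P" "c \<bullet> x > c \<bullet> v"
  obtains w where "adj P v w" "c \<bullet> w > c \<bullet> v"
proof -
  have vf: "{v} face_of P"
    using v by (simp add: vertices_def face_of_singleton)
  obtain a b where ab: "\<And>x. x \<in> P \<Longrightarrow> a \<bullet> x \<le> b" "{v} = P \<inter> {x. a \<bullet> x = b}"
    using polytope_face_exposed[OF P vf] by blast
  have av: "a \<bullet> v = b" and alt: "\<And>x. x \<in> P \<Longrightarrow> x \<noteq> v \<Longrightarrow> a \<bullet> x < b"
    using ab by (auto simp: order.strict_iff_order)
  have "\<not> (\<forall>y\<in>vertices P. c \<bullet> y \<le> c \<bullet> v)"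
    using polytope_le_if_vertices_le[OF P, of c "c \<bullet> v" x] x by force
  then obtain y where y: "y \<in> vertices P" "c \<bullet> y > c \<bullet> v" by force
  let ?V = "vertices P - {v}"
  have fV: "finite ?V" "?V \<noteq> {}"
    using finite_vertices[OF P] y by auto
  \<comment> \<open>Halfway between the highest remaining vertex and \<open>b\<close>, so that
    \<open>v\<close> is the only vertex at height \<open>h\<close> or more.\<close>
  define h where "h = (Max ((\<bullet>) a ` ?V) + b) / 2"
  have "Max ((\<bullet>) a ` ?V) \<in> (\<bullet>) a ` ?V"
    using fV by (intro Max_in) auto
  then have "Max ((\<bullet>) a ` ?V) < b"
    using alt vertices_subset[of P] by (force simp del: Max_in)
  then have hb: "h < b" and hM: "Max ((\<bullet>) a ` ?V) < h" by (auto simp: h_def)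
  have hlt: "a \<bullet> w < h" if "w \<in> ?V" for w
    using hM fV that by (simp add: Max_less_iff)
  define Q where "Q = P \<inter> {x. a \<bullet> x = h}"
  have pQ: "polytope Q"
    unfolding Q_def using P by (simp add: polytope_Int_polyhedron polyhedron_hyperplane)
  have ayh: "a \<bullet> y < h" using hlt y by auto
  \<comment> \<open>The parameter at which the segment from \<open>v\<close> (height
    \<open>b\<close>) to \<open>y\<close> (height below \<open>h\<close>) crosses the
    section.\<close>
  define s where "s = (b - h) / (b - a \<bullet> y)"
  have s: "0 < s" "s < 1" using ayh hb by (auto simp: s_def)
  define z where "z = (1 - s) *\<^sub>R v + s *\<^sub>R y"
  have "z \<in> P"
    unfolding z_def using P v y s vertices_subset[of P] polytope_imp_convex[OF P]
    by (intro convexD) auto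
  moreover have "a \<bullet> z = h"
  proof -
    have "a \<bullet> z = b - s * (b - a \<bullet> y)"
      by (simp add: z_def inner_add_right av algebra_simps)
    then show ?thesis using ayh hb by (simp add: s_def)
  qed
  ultimately have zQ: "z \<in> Q" by (simp add: Q_def)
  have cz: "c \<bullet> z > c \<bullet> v"
  proof -
    have "c \<bullet> z - c \<bullet> v = s * (c \<bullet> y - c \<bullet> v)"
      by (simp add: z_def inner_add_right algebra_simps)
    moreover have "s * (c \<bullet> y - c \<bullet> v) > 0" using s y by simp
    ultimately show ?thesis by linarith
  qed
  have "\<not> (\<forall>q\<in>vertices Q. c \<bullet> q \<le> c \<bullet> v)"
    using polytope_le_if_vertices_le[OF pQ, of c "c \<bullet> v" z] zQ cz by force
  then obtain q where q: "q \<in> vertices Q" "c \<bullet> q > c \<bullet> v" by force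
  then have "q extreme_point_of (P \<inter> {x. a \<bullet> x = h})" by (simp add: vertices_def Q_def)
  then obtain G where G: "G face_of P" "q \<in> G" "aff_dim G \<le> 1"
    using extreme_point_of_hyperplane_section[OF P] by blast
  have aq: "a \<bullet> q = h" using q vertices_subset Q_def by auto
  have pG: "polytope G" using G P face_of_polytope_polytope by blast
  \<comment> \<open>A face through a point of height \<open>h\<close> has a vertex at least that
    high, which can only be \<open>v\<close>. Since \<open>q\<close> differs from \<open>v\<close>,
    the face \<open>G\<close> is an edge at \<open>v\<close>.\<close>
  have "\<not> (\<forall>u\<in>vertices G. a \<bullet> u < h)"
    using polytope_less_if_vertices_less[OF pG, of a h q] G aq by force
  then obtain u where u: "u \<in> vertices G" "\<not> a \<bullet> u < h" by blast
  then have "u \<in> vertices P" using G vertices_face by blast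
  then have "u = v" using u hlt by blast
  then have vG: "v \<in> G" using u vertices_subset by blast
  have "q \<noteq> v" using q by auto
  then have "\<not> G \<subseteq> {v}" using G by blast
  then have "aff_dim G \<noteq> 0" using vG by (metis aff_dim_eq_0 singletonD subsetI)
  moreover have "aff_dim G \<noteq> -1" using vG by (metis aff_dim_empty empty_iff)
  ultimately have "aff_dim G = 1" using G aff_dim_geq[of G] by linarith
  then have "G \<in> edges P" using G by (simp add: edges_def edge_of_def)
  then obtain w where w: "G = closed_segment v w" "adj P v w"
    using edge_eq_segment_at[OF P _ v vG] by blast
  obtain r where r: "0 \<le> r" "r \<le> 1" "q = (1 - r) *\<^sub>R v + r *\<^sub>R w"
    using G w by (auto simp: in_segment)
  have "c \<bullet> q - c \<bullet> v = r * (c \<bullet> w - c \<bullet> v)"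
    by (simp add: r inner_add_right algebra_simps)
  then have "r * (c \<bullet> w - c \<bullet> v) > 0" using q by simp
  then have "c \<bullet> w > c \<bullet> v" using r by (simp add: zero_less_mult_iff)
  then show thesis using that w by blast
qed

subsection \<open>Polygons and connectivity\<close>

text \<open>The quotient \<open>X / Y\<close> is positive. Using \<open>sgn\<close> covers vanishing
  coefficients too, so that three such relations can force all coefficients to be 0.\<close>

lemma opposite_sgn:
  fixes X Y \<beta> \<gamma> :: real
  assumes "\<beta> * X + \<gamma> * Y = 0" "X < 0" "Y < 0"
  shows "sgn \<gamma> = - sgn \<beta>"
proof -
  have "\<gamma> = - (\<beta> * (X / Y))" using assms by (simp add: field_simps)
  moreover have "sgn (X / Y) = 1" using assms by (simp add: divide_neg_neg)
  ultimately show ?thesis by (simp only: sgn_minus sgn_mult mult_1_right)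
qed

lemma other_vertex_not_in_edge:
  fixes P :: "'a::euclidean_space set"
  assumes "adj P v x" "y \<in> vertices P" "y \<noteq> v" "y \<noteq> x"
  shows "y \<notin> closed_segment v x"
proof
  assume "y \<in> closed_segment v x"
  then have "y \<in> vertices (closed_segment v x)"
    using assms edge_face[OF adj_edge[OF assms(1)]] vertices_face by blast
  then show False using assms vertices_segment by blast
qed

lemma edge_exposed:
  fixes P :: "'a::euclidean_space set"
  assumes "polytope P" "adj P v x"
  obtains a b where "a \<bullet> v = b" "a \<bullet> x = b" "\<And>y. y \<in> P \<Longrightarrow> y \<notin> closed_segment v x \<Longrightarrow> a \<bullet> y < b"
    "\<And>y. y \<in> P \<Longrightarrow> y \<in> closed_segment v x \<Longrightarrow> a \<bullet> y = b"
proof -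
  obtain a b where ab: "\<And>x. x \<in> P \<Longrightarrow> a \<bullet> x \<le> b" "closed_segment v x = P \<inter> {x. a \<bullet> x = b}"
    using polytope_face_exposed[OF assms(1) edge_face[OF adj_edge[OF assms(2)]]] by blast
  show thesis
  proof (rule that)
    show "a \<bullet> v = b" "a \<bullet> x = b" using ab(2) ends_in_segment[of v x] by blast+
  next
    fix y assume "y \<in> P" "y \<notin> closed_segment v x"
    then show "a \<bullet> y < b" using ab(1)[of y] unfolding ab(2) by auto
  next
    fix y assume "y \<in> closed_segment v x"
    then show "a \<bullet> y = b" unfolding ab(2) by auto
  qed
qed

text \<open>The three edge directions at \<open>v\<close> would satisfy a linear relation. Evaluating the functional that
  exposes one of the edges shows that the coefficients of the other two have opposite signs, which is
  impossible for all three pairs.\<close>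

lemma polygon_neighbours_eq:
  fixes F :: "'a::euclidean_space set"
  assumes F: "polytope F" "aff_dim F = 2"
    and adj: "adj F v p" "adj F v q" "adj F v r" and neq: "p \<noteq> q" "p \<noteq> r"
  shows "q = r"
proof (rule ccontr)
  assume qr: "q \<noteq> r"
  have vtx: "v \<in> F" "p \<in> vertices F" "q \<in> vertices F" "r \<in> vertices F"
    using adj adj_vertex adj_vertex2 vertices_subset by blast+
  have sep: "\<exists>a. a \<bullet> (x - v) = 0 \<and> a \<bullet> (y - v) < 0 \<and> a \<bullet> (z - v) < 0"
    if h: "adj F v x" "adj F v y" "adj F v z" "y \<noteq> x" "z \<noteq> x" for x y z
  proof -
    obtain a b where ab: "a \<bullet> v = b" "a \<bullet> x = b"
      "\<And>y. y \<in> F \<Longrightarrow> y \<notin> closed_segment v x \<Longrightarrow> a \<bullet> y < b"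
      using edge_exposed[OF F(1) h(1)] by metis
    have "y \<in> vertices F" "z \<in> vertices F" "y \<noteq> v" "z \<noteq> v"
      using h adj_vertex2 adj_neq by blast+
    then have "a \<bullet> y < b" "a \<bullet> z < b"
      using ab(3) other_vertex_not_in_edge[OF h(1)] h vertices_subset by blast+
    then show ?thesis using ab by (auto simp: inner_diff_right)
  qed
  let ?S = "{p - v, q - v, r - v}"
  have "card ?S = 3" using neq qr by simp
  moreover have "dim ?S \<le> 2"
  proof -
    \<comment> \<open>Moving \<open>v\<close> to the origin turns the affine hull of
      \<open>F\<close> into a linear plane, which contains all three directions.\<close>
    have "?S \<subseteq> (\<lambda>x. - v + x) ` F" using vtx vertices_subset by force
    then have "dim ?S \<le> dim ((\<lambda>x. - v + x) ` F)" by (rule dim_subset)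
    moreover have "aff_dim F = int (dim ((\<lambda>x. - v + x) ` F))"
      using vtx by (intro aff_dim_eq_dim) (simp add: hull_inc)
    ultimately show ?thesis using F by simp
  qed
  ultimately have "dependent ?S"
    using dim_eq_card_independent[of ?S] by force
  then obtain f where f: "\<exists>x\<in>?S. f x \<noteq> 0" "(\<Sum>x\<in>?S. f x *\<^sub>R x) = 0"
    by (subst (asm) real_vector.dependent_finite) auto
  define \<alpha> \<beta> \<gamma> where "\<alpha> = f (p - v)" and "\<beta> = f (q - v)" and "\<gamma> = f (r - v)"
  have z: "\<alpha> *\<^sub>R (p - v) + \<beta> *\<^sub>R (q - v) + \<gamma> *\<^sub>R (r - v) = 0"
    using f(2) neq qr by (simp add: \<alpha>_def \<beta>_def \<gamma>_def add.assoc)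
  have zi: "\<alpha> * (a \<bullet> (p - v)) + \<beta> * (a \<bullet> (q - v)) + \<gamma> * (a \<bullet> (r - v)) = 0" for a
    using arg_cong[OF z, of "(\<bullet>) a"] by (simp only: inner_add_right inner_scaleR_right inner_zero_right)
  have "sgn \<gamma> = - sgn \<beta>"
  proof -
    obtain a where "a \<bullet> (p - v) = 0" "a \<bullet> (q - v) < 0" "a \<bullet> (r - v) < 0"
      using sep[of p q r] adj neq by auto
    then show ?thesis using zi[of a] by (intro opposite_sgn[of \<beta> "a \<bullet> (q - v)" \<gamma> "a \<bullet> (r - v)"]) auto
  qed
  moreover have "sgn \<gamma> = - sgn \<alpha>"
  proof -
    obtain a where "a \<bullet> (q - v) = 0" "a \<bullet> (p - v) < 0" "a \<bullet> (r - v) < 0"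
      using sep[of q p r] adj neq qr by auto
    then show ?thesis using zi[of a] by (intro opposite_sgn[of \<alpha> "a \<bullet> (p - v)" \<gamma> "a \<bullet> (r - v)"]) auto
  qed
  moreover have "sgn \<beta> = - sgn \<alpha>"
  proof -
    obtain a where "a \<bullet> (r - v) = 0" "a \<bullet> (p - v) < 0" "a \<bullet> (q - v) < 0"
      using sep[of r p q] adj neq qr by auto
    then show ?thesis using zi[of a] by (intro opposite_sgn[of \<alpha> "a \<bullet> (p - v)" \<beta> "a \<bullet> (q - v)"]) auto
  qed
  ultimately have "sgn \<alpha> = 0" "sgn \<beta> = 0" "sgn \<gamma> = 0" by linarith+
  then show False using f(1) by (auto simp: \<alpha>_def \<beta>_def \<gamma>_def sgn_eq_0_iff)
qed

text \<open>A polygon has points off the edge \<open>vu\<close>. There the functional exposing the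
  edge is smaller than at \<open>v\<close>, so some neighbour of \<open>v\<close> decreases it, and
  this neighbour cannot be \<open>u\<close>.\<close>

lemma ex_other_neighbour:
  fixes F :: "'a::euclidean_space set"
  assumes F: "polytope F" "aff_dim F = 2" and adj: "adj F v u"
  shows "\<exists>w. w \<noteq> u \<and> adj F v w"
proof -
  obtain a b where ab: "a \<bullet> v = b" "a \<bullet> u = b"
    "\<And>y. y \<in> F \<Longrightarrow> y \<notin> closed_segment v u \<Longrightarrow> a \<bullet> y < b"
    using edge_exposed[OF F(1) adj] by metis
  have "closed_segment v u \<noteq> F" using adj F by (auto simp: adj_def edge_of_def)
  moreover have "closed_segment v u \<subseteq> F"
    using adj by (auto simp: adj_def edge_of_def dest: face_of_imp_subset)
  ultimately obtain x where "x \<in> F" "x \<notin> closed_segment v u" by blast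
  then have "x \<in> F" "(- a) \<bullet> x > (- a) \<bullet> v" using ab by auto
  then obtain w where "adj F v w" "(- a) \<bullet> w > (- a) \<bullet> v"
    using improving_neighbour[OF F(1) adj_vertex[OF adj]] by blast
  then show ?thesis using ab by (intro exI[of _ w]) auto
qed

section \<open>Connectivity of the graph above a threshold\<close>

text \<open>Ascent as in the simplex method: each improving neighbour leaves fewer vertices above
  the current one. As \<open>c\<close> increases along the path, the threshold
  \<open>\<beta>\<close> is never violated.\<close>

lemma climb:
  fixes P :: "'a::euclidean_space set"
  assumes P: "polytope P" and x: "x \<in> vertices P" "c \<bullet> x > \<beta>"
  shows "\<exists>x'\<in>vertices P. (\<lambda>v w. adj P v w \<and> c \<bullet> v > \<beta> \<and> c \<bullet> w > \<beta>)\<^sup>*\<^sup>* x x' \<and> (\<forall>z\<in>P. c \<bullet> z \<le> c \<bullet> x')"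
  using x
proof (induction "card {w \<in> vertices P. c \<bullet> w > c \<bullet> x}" arbitrary: x rule: less_induct)
  case less
  show ?case
  proof (cases "\<forall>z\<in>P. c \<bullet> z \<le> c \<bullet> x")
    case True
    then show ?thesis using less.prems by blast
  next
    case False
    then obtain z where "z \<in> P" "c \<bullet> z > c \<bullet> x" by force
    then obtain w where w: "adj P x w" "c \<bullet> w > c \<bullet> x"
      using improving_neighbour[OF P less.prems(1)] by blast
    have wv: "w \<in> vertices P" using w adj_vertex2 by blast
    have "{y \<in> vertices P. c \<bullet> y > c \<bullet> w} \<subset> {y \<in> vertices P. c \<bullet> y > c \<bullet> x}"
      using w wv by fastforce
    then have "card {y \<in> vertices P. c \<bullet> y > c \<bullet> w} < card {y \<in> vertices P. c \<bullet> y > c \<bullet> x}"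
      using finite_vertices[OF P] by (intro psubset_card_mono) auto
    then obtain x' where "x' \<in> vertices P" "(\<lambda>v w. adj P v w \<and> c \<bullet> v > \<beta> \<and> c \<bullet> w > \<beta>)\<^sup>*\<^sup>* w x'"
      "\<forall>z\<in>P. c \<bullet> z \<le> c \<bullet> x'"
      using less.hyps[of w] wv w less.prems by force
    moreover have "adj P x w \<and> c \<bullet> x > \<beta> \<and> c \<bullet> w > \<beta>" using w less.prems by simp
    ultimately show ?thesis
      by (metis (mono_tags, lifting) converse_rtranclp_into_rtranclp)
  qed
qed

text \<open>Climb from both ends to the face on which \<open>c\<close> is maximal, and connect there by induction on the
  dimension. If \<open>c\<close> is constant, any functional separating \<open>x\<close> and \<open>y\<close> serves instead.\<close>

lemma connected_above:
  fixes P :: "'a::euclidean_space set"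
  assumes "polytope P" "x \<in> vertices P" "y \<in> vertices P" "c \<bullet> x > \<beta>" "c \<bullet> y > \<beta>"
  shows "(\<lambda>v w. adj P v w \<and> c \<bullet> v > \<beta> \<and> c \<bullet> w > \<beta>)\<^sup>*\<^sup>* x y"
  using assms
proof (induction "nat (aff_dim P + 1)" arbitrary: P x y c \<beta> rule: less_induct)
  case less
  have nonconst: "(\<lambda>v w. adj P v w \<and> c \<bullet> v > \<beta> \<and> c \<bullet> w > \<beta>)\<^sup>*\<^sup>* x y"
    if c: "c \<bullet> x > \<beta>" "c \<bullet> y > \<beta>" and pq: "p \<in> P" "q \<in> P" "c \<bullet> p \<noteq> c \<bullet> q" for c \<beta> p q
  proof -
    let ?R = "\<lambda>v w. adj P v w \<and> c \<bullet> v > \<beta> \<and> c \<bullet> w > \<beta>"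
    obtain x' where x': "x' \<in> vertices P" "?R\<^sup>*\<^sup>* x x'" "\<forall>z\<in>P. c \<bullet> z \<le> c \<bullet> x'"
      using climb[OF less.prems(1,2) c(1)] by blast
    obtain y' where y': "y' \<in> vertices P" "?R\<^sup>*\<^sup>* y y'" "\<forall>z\<in>P. c \<bullet> z \<le> c \<bullet> y'"
      using climb[OF less.prems(1,3) c(2)] by blast
    define M where "M = c \<bullet> x'"
    define T where "T = P \<inter> {z. c \<bullet> z = M}"
    have xy': "x' \<in> P" "y' \<in> P" using x' y' vertices_subset by blast+
    have M: "c \<bullet> x' = M" "c \<bullet> y' = M"
      using x'(3) y'(3) xy' by (auto simp: M_def intro: antisym)
    have T: "T face_of P"
      unfolding T_def using x'(3) less.prems(1)
      by (intro face_of_Int_supporting_hyperplane_le) (auto simp: M_def polytope_imp_convex)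
    \<comment> \<open>Non-constancy of \<open>c\<close> makes the maximal face proper, so the
      dimension drops.\<close>
    have "T \<noteq> P" using pq unfolding T_def by (metis IntD2 mem_Collect_eq)
    then have "aff_dim T < aff_dim P"
      using T less.prems(1) face_of_aff_dim_lt polytope_imp_convex by blast
    then have "nat (aff_dim T + 1) < nat (aff_dim P + 1)"
      using aff_dim_geq[of T] by linarith
    moreover have "polytope T" using T less.prems(1) face_of_polytope_polytope by blast
    moreover have "x' \<in> vertices T" "y' \<in> vertices T"
      using x' y' T M xy' by (auto simp: vertices_face T_def)
    moreover have "c \<bullet> x' > \<beta>" "c \<bullet> y' > \<beta>"
      using c x' y' less.prems vertices_subset M by fastforce+
    ultimately have "(\<lambda>v w. adj T v w \<and> c \<bullet> v > \<beta> \<and> c \<bullet> w > \<beta>)\<^sup>*\<^sup>* x' y'"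
      using less.hyps by blast
    then have "?R\<^sup>*\<^sup>* x' y'"
      by (rule rtranclp_mono[THEN predicate2D, rotated]) (auto simp: adj_face_iff[OF T])
    moreover have "?R\<^sup>*\<^sup>* y' y"
    proof -
      have "symp ?R" by (auto simp: symp_def adj_sym)
      then have "symp ?R\<^sup>*\<^sup>*" by (rule symp_rtranclp)
      then show ?thesis using y'(2) by (rule sympD)
    qed
    ultimately show ?thesis using x'(2) by (meson rtranclp_trans)
  qed
  show ?case
  proof (cases "\<exists>p\<in>P. \<exists>q\<in>P. c \<bullet> p \<noteq> c \<bullet> q")
    case True
    then show ?thesis using nonconst less.prems by blast
  next
    case const: False
    show ?thesis
    proof (cases "x = y")
      case False
      let ?c = "x - y"
      \<comment> \<open>Subtracting 1 puts both ends strictly above the threshold.\<close>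
      let ?\<beta> = "min (?c \<bullet> x) (?c \<bullet> y) - 1"
      have "?c \<bullet> x - ?c \<bullet> y \<noteq> 0" using False by (simp flip: inner_diff_right)
      then have "?c \<bullet> x \<noteq> ?c \<bullet> y" by simp
      then have "(\<lambda>v w. adj P v w \<and> ?c \<bullet> v > ?\<beta> \<and> ?c \<bullet> w > ?\<beta>)\<^sup>*\<^sup>* x y"
        using less.prems vertices_subset by (intro nonconst[of ?\<beta> ?c x y]) auto
      then show ?thesis
      proof (rule rtranclp_mono[THEN predicate2D, rotated], intro predicate2I)
        fix v w assume "adj P v w \<and> ?c \<bullet> v > ?\<beta> \<and> ?c \<bullet> w > ?\<beta>"
        then have "adj P v w" "v \<in> P" "w \<in> P" "x \<in> P"
          using adj_vertex adj_vertex2 vertices_subset less.prems by blast+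
        \<comment> \<open>Since \<open>c\<close> is constant on \<open>P\<close>, its bound at
          \<open>x\<close> carries over to every vertex of the path.\<close>
        then show "adj P v w \<and> c \<bullet> v > \<beta> \<and> c \<bullet> w > \<beta>"
          using const less.prems by metis
      qed
    qed simp
  qed
qed

text \<open>The edge is where its exposing functional attains the maximum \<open>b\<close>, so the
  vertices off it are those in an open half-space. In a polygon the resulting path is the boundary
  arc opposite the edge.\<close>

lemma connected_off_edge:
  fixes F :: "'a::euclidean_space set"
  assumes F: "polytope F" and adj: "adj F u v"
    and w: "w \<in> vertices F" "w \<notin> closed_segment u v" "w' \<in> vertices F" "w' \<notin> closed_segment u v"
  shows "(\<lambda>x y. adj F x y \<and> x \<notin> closed_segment u v \<and> y \<notin> closed_segment u v)\<^sup>*\<^sup>* w w'"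
proof -
  obtain a b where ab: "\<And>y. y \<in> F \<Longrightarrow> y \<notin> closed_segment u v \<Longrightarrow> a \<bullet> y < b"
    "\<And>y. y \<in> F \<Longrightarrow> y \<in> closed_segment u v \<Longrightarrow> a \<bullet> y = b"
    using edge_exposed[OF F(1) adj] by metis
  have wF: "w \<in> F" "w' \<in> F" using w vertices_subset by blast+
  have "(\<lambda>x y. adj F x y \<and> (- a) \<bullet> x > - b \<and> (- a) \<bullet> y > - b)\<^sup>*\<^sup>* w w'"
    using ab wF w F by (intro connected_above) auto
  then show ?thesis
  proof (rule rtranclp_mono[THEN predicate2D, rotated], intro predicate2I)
    fix x y assume h: "adj F x y \<and> (- a) \<bullet> x > - b \<and> (- a) \<bullet> y > - b"
    then have "x \<in> F" "y \<in> F" using adj_vertex adj_vertex2 vertices_subset by blast+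
    then show "adj F x y \<and> x \<notin> closed_segment u v \<and> y \<notin> closed_segment u v"
      using h ab(2) by force
  qed
qed

lemma graph_connected:
  fixes P :: "'a::euclidean_space set"
  assumes "polytope P" "x \<in> vertices P" "y \<in> vertices P"
  shows "(adj P)\<^sup>*\<^sup>* x y"
  \<comment> \<open>The zero functional exceeds -1 everywhere, so the threshold imposes no
    restriction.\<close>
  using connected_above[OF assms, of "-1" 0] by simp

subsection \<open>Parallel neighbours and the Laplacian\<close>

definition nbrs :: "'a::euclidean_space set \<Rightarrow> 'a \<Rightarrow> 'a set" where
  "nbrs P v = {w. adj P v w}"

lemma finite_nbrs:
  fixes P :: "'a::euclidean_space set"
  assumes "polytope P"
  shows "finite (nbrs P v)"
  by (rule finite_subset[OF _ finite_vertices[OF assms]]) (auto simp: nbrs_def adj_vertex2)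

lemma inj_on_segment:
  fixes v :: "'a::euclidean_space"
  shows "inj_on (closed_segment v) A"
proof (rule inj_onI)
  fix x y :: 'a assume "closed_segment v x = closed_segment v y"
  then have "{v, x} = {v, y}" using vertices_segment by metis
  then show "x = y" by (auto simp: doubleton_eq_iff)
qed

lemma edges_at_vertex:
  fixes P :: "'a::euclidean_space set"
  assumes "polytope P" "v \<in> vertices P"
  shows "{e \<in> edges P. v \<in> e} = closed_segment v ` nbrs P v"
proof
  show "{e \<in> edges P. v \<in> e} \<subseteq> closed_segment v ` nbrs P v"
  proof
    fix e assume "e \<in> {e \<in> edges P. v \<in> e}"
    then obtain w where "e = closed_segment v w" "adj P v w"
      using edge_eq_segment_at[OF assms(1) _ assms(2)] by blast
    then show "e \<in> closed_segment v ` nbrs P v" by (simp add: nbrs_def)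
  qed
qed (auto simp: nbrs_def adj_edge)

lemma vertex_degree_eq:
  fixes P :: "'a::euclidean_space set"
  assumes "polytope P" "v \<in> vertices P"
  shows "vertex_degree P v = card (nbrs P v)"
  unfolding vertex_degree_def edges_at_vertex[OF assms]
  by (rule card_image[OF inj_on_segment])

text \<open>The intersection is a face. If it were larger than the edge, its dimension would exceed
  1; as a proper face of a polygon it has dimension below 2. It is proper in \<open>F\<close>, for
  otherwise \<open>F\<close> would be a proper face of \<open>G\<close> of equal dimension.\<close>

lemma two_faces_Int:
  fixes P :: "'a::euclidean_space set"
  assumes "adj P u v" and F: "F \<in> faces_up P (closed_segment u v)"
    and G: "G \<in> faces_up P (closed_segment u v)" and "F \<noteq> G"
  shows "F \<inter> G = closed_segment u v"
proof (rule ccontr)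
  let ?e = "closed_segment u v"
  assume ne: "F \<inter> G \<noteq> ?e"
  have FG: "F face_of P" "G face_of P" "aff_dim F = 2" "aff_dim G = 2" "?e \<subseteq> F \<inter> G"
    using F G by (auto simp: faces_up_def two_faces_def)
  have I: "F \<inter> G face_of P" using FG face_of_Int by blast
  have e: "?e face_of P" "aff_dim ?e = 1" using assms by (auto simp: adj_def edge_of_def)
  have "?e face_of F \<inter> G" using face_of_face[OF I] e FG by blast
  then have "aff_dim ?e < aff_dim (F \<inter> G)"
    using ne face_of_aff_dim_lt[of "F \<inter> G" ?e] I face_of_imp_convex by blast
  moreover have "aff_dim (F \<inter> G) < 2"
  proof (cases "F \<inter> G = F")
    case True
    then have "F face_of G" using face_of_face[OF FG(2)] FG by blast
    then have "aff_dim F < aff_dim G"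
      using \<open>F \<noteq> G\<close> face_of_aff_dim_lt FG face_of_imp_convex by blast
    then show ?thesis using FG by simp
  next
    case False
    have "F \<inter> G face_of F" using face_of_face[OF FG(1)] I by blast
    then show ?thesis
      using False face_of_aff_dim_lt[of F "F \<inter> G"] FG face_of_imp_convex by metis
  qed
  ultimately show False using e by linarith
qed

text \<open>The next boundary vertex of the polygon \<open>F\<close> after \<open>u\<close> when
  coming from \<open>v\<close>; \<open>THE\<close> is justified because a polygon vertex has exactly
  two neighbours.\<close>

definition opp :: "'a::euclidean_space set \<Rightarrow> 'a \<Rightarrow> 'a \<Rightarrow> 'a" where
  "opp F u v = (THE w. w \<noteq> v \<and> adj F u w)"

lemma ex1_other_neighbour:
  fixes F :: "'a::euclidean_space set"
  assumes "polytope F" "aff_dim F = 2" "adj F u v"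
  shows "\<exists>!w. w \<noteq> v \<and> adj F u w"
  using ex_other_neighbour[OF assms] polygon_neighbours_eq[OF assms] by metis

lemma faces_upD:
  fixes P :: "'a::euclidean_space set"
  assumes "polytope P" "adj P u v" "F \<in> faces_up P (closed_segment u v)"
  shows "F face_of P" "polytope F" "aff_dim F = 2" "adj F u v"
  using assms face_of_polytope_polytope by (auto simp: faces_up_def two_faces_def adj_face)

lemma opp_props:
  fixes P :: "'a::euclidean_space set"
  assumes "polytope P" "adj P u v" "F \<in> faces_up P (closed_segment u v)"
  shows "opp F u v \<noteq> v" "adj F u (opp F u v)" "\<And>w. w \<noteq> v \<Longrightarrow> adj F u w \<Longrightarrow> opp F u v = w"
proof -
  note ex1 = ex1_other_neighbour[OF faces_upD(2-4)[OF assms]]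
  show "opp F u v \<noteq> v" "adj F u (opp F u v)"
    using theI'[OF ex1] unfolding opp_def by auto
  show "\<And>w. w \<noteq> v \<Longrightarrow> adj F u w \<Longrightarrow> opp F u v = w"
    unfolding opp_def by (rule the1_equality[OF ex1]) auto
qed

text \<open>The endpoints of the parallel neighbours that share the vertex \<open>u\<close> with \<open>uv\<close>.\<close>

definition free_nbrs :: "'a::euclidean_space set \<Rightarrow> 'a \<Rightarrow> 'a \<Rightarrow> 'a set" where
  "free_nbrs P u v = {w. adj P u w \<and> w \<noteq> v \<and>
     \<not> in_common_two_face P (closed_segment u v) (closed_segment u w)}"

text \<open>A neighbour of \<open>u\<close> other than \<open>v\<close> is either free or lies in a
  2-face with \<open>uv\<close>, where it must be the second neighbour of \<open>u\<close>. Distinct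
  2-faces give distinct neighbours because they meet only in \<open>uv\<close>.\<close>

lemma opp_bij:
  fixes P :: "'a::euclidean_space set"
  assumes P: "polytope P" and uv: "adj P u v"
  shows "bij_betw (\<lambda>F. opp F u v) (faces_up P (closed_segment u v))
    (nbrs P u - insert v (free_nbrs P u v))"
proof (rule bij_betw_imageI)
  let ?U = "faces_up P (closed_segment u v)"
  note props = opp_props[OF P uv] and upD = faces_upD[OF P uv]
  show "inj_on (\<lambda>F. opp F u v) ?U"
  proof (rule inj_onI, rule ccontr)
    fix F G assume h: "F \<in> ?U" "G \<in> ?U" "opp F u v = opp G u v" "F \<noteq> G"
    let ?w = "opp F u v"
    have "?w \<in> F" "?w \<in> G"
      using props(2)[OF h(1)] props(2)[OF h(2)] h adj_vertex2 vertices_subset by (metis subsetD)+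
    then have "?w \<in> closed_segment u v" using two_faces_Int[OF uv h(1,2,4)] by blast
    moreover have w: "adj P u ?w" using props(2)[OF h(1)] upD(1)[OF h(1)] adj_face by blast
    ultimately show False
      using other_vertex_not_in_edge[OF uv] props(1)[OF h(1)] adj_vertex2[OF w] adj_neq[OF w] by metis
  qed
  show "(\<lambda>F. opp F u v) ` ?U = nbrs P u - insert v (free_nbrs P u v)"
  proof (intro equalityI subsetI)
    fix w assume "w \<in> (\<lambda>F. opp F u v) ` ?U"
    then obtain F where F: "F \<in> ?U" "w = opp F u v" by blast
    have "adj F u w" "w \<noteq> v" using props F by auto
    then have "adj P u w" "closed_segment u w \<subseteq> F" using adj_face upD(1) F by blast+
    then show "w \<in> nbrs P u - insert v (free_nbrs P u v)"
      using F \<open>w \<noteq> v\<close>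
      by (auto simp: nbrs_def free_nbrs_def in_common_two_face_def faces_up_def)
  next
    fix w assume "w \<in> nbrs P u - insert v (free_nbrs P u v)"
    then have w: "adj P u w" "w \<noteq> v" "in_common_two_face P (closed_segment u v) (closed_segment u w)"
      by (auto simp: nbrs_def free_nbrs_def)
    then obtain F where F: "F \<in> ?U" "closed_segment u w \<subseteq> F"
      by (auto simp: in_common_two_face_def faces_up_def)
    then have "adj F u w" using adj_face upD(1) w by blast
    then have "opp F u v = w" using props(3) F w by blast
    then show "w \<in> (\<lambda>F. opp F u v) ` ?U" using F by blast
  qed
qed

lemma finite_faces_up:
  fixes P :: "'a::euclidean_space set"
  assumes "polytope P"
  shows "finite (faces_up P e)"
  by (rule finite_subset[OF _ finite_polytope_faces[OF assms]]) (auto simp: faces_up_def two_faces_def)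

text \<open>Taking \<open>g\<close> constantly 1 counts the degree; taking potential differences
  expands the Laplacian. Applied at both ends of \<open>uv\<close>, it ranges over the same
  2-faces.\<close>

lemma sum_nbrs:
  fixes P :: "'a::euclidean_space set" and g :: "'a \<Rightarrow> int"
  assumes P: "polytope P" and uv: "adj P u v"
  shows "(\<Sum>w\<in>nbrs P u. g w) = g v + (\<Sum>w\<in>free_nbrs P u v. g w)
    + (\<Sum>F\<in>faces_up P (closed_segment u v). g (opp F u v))"
proof -
  have sub: "insert v (free_nbrs P u v) \<subseteq> nbrs P u" "v \<notin> free_nbrs P u v"
    using uv by (auto simp: nbrs_def free_nbrs_def)
  then have fin: "finite (free_nbrs P u v)"
    using finite_nbrs[OF P] finite_subset by (metis insert_subset)
  have "(\<Sum>w\<in>nbrs P u. g w)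
      = (\<Sum>w\<in>insert v (free_nbrs P u v). g w) + (\<Sum>w\<in>nbrs P u - insert v (free_nbrs P u v). g w)"
    using sum.subset_diff[OF sub(1) finite_nbrs[OF P], of g] by simp
  also have "(\<Sum>w\<in>nbrs P u - insert v (free_nbrs P u v). g w)
      = (\<Sum>F\<in>faces_up P (closed_segment u v). g (opp F u v))"
    using sum.reindex_bij_betw[OF opp_bij[OF P uv], of g] by simp
  finally show ?thesis using fin sub(2) by simp
qed

definition disjoint_edges :: "'a::euclidean_space set \<Rightarrow> 'a set \<Rightarrow> 'a set \<Rightarrow> 'a set set" where
  "disjoint_edges P e F = {f \<in> edges P. f \<subseteq> F \<and> \<not> share_vertex P e f}"

lemma finite_edges:
  fixes P :: "'a::euclidean_space set"
  assumes "polytope P"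
  shows "finite (edges P)"
  by (rule finite_subset[OF _ finite_polytope_faces[OF assms]]) (auto simp: edges_def edge_of_def)

text \<open>The three families are disjoint: the first two meet \<open>e\<close> at different ends,
  and the last avoids its vertices. A lower bound is what positivity, an upper bound on the parallel
  neighbours, has to be played against.\<close>

lemma card_parallel_neighbors_ge:
  fixes P :: "'a::euclidean_space set"
  assumes P: "polytope P" and uv: "adj P u v"
  defines "e \<equiv> closed_segment u v"
  shows "card (free_nbrs P u v) + card (free_nbrs P v u) + (\<Sum>F\<in>faces_up P e. card (disjoint_edges P e F))
    \<le> card (parallel_neighbors P e)"
proof -
  let ?A = "closed_segment u ` free_nbrs P u v" and ?B = "closed_segment v ` free_nbrs P v u"
  let ?C = "\<Union>F\<in>faces_up P e. disjoint_edges P e F"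
  have fin: "finite (edges P)" by (rule finite_edges[OF P])
  have vtx: "u \<in> vertices P" "v \<in> vertices P" "u \<in> e" "v \<in> e"
    using uv adj_vertex adj_vertex2 by (auto simp: e_def)
  have vu: "adj P v u" using uv adj_sym by blast
  have ec: "e = closed_segment v u" by (simp add: e_def closed_segment_commute)
  have free: "closed_segment x ` free_nbrs P x y
      \<subseteq> {f \<in> edges P. f \<noteq> e \<and> share_vertex P e f \<and> \<not> in_common_two_face P e f}"
    if xy: "adj P x y" "e = closed_segment x y" for x y
  proof
    fix f assume "f \<in> closed_segment x ` free_nbrs P x y"
    then obtain z where z: "f = closed_segment x z" "adj P x z" "z \<noteq> y" "\<not> in_common_two_face P e f"
      unfolding xy(2) free_nbrs_def by blast
    have "f \<noteq> e" using z xy inj_onD[OF inj_on_segment[of x UNIV]] by blast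
    moreover have "share_vertex P e f"
      unfolding share_vertex_def using adj_vertex[OF xy(1)] z(1) xy(2) by auto
    ultimately show "f \<in> {f \<in> edges P. f \<noteq> e \<and> share_vertex P e f \<and> \<not> in_common_two_face P e f}"
      using z adj_edge by blast
  qed
  have "e = closed_segment u v" by (simp add: e_def)
  note A = free[OF uv this] and B = free[OF vu ec]
  have notshare: "f \<noteq> e" if "\<not> share_vertex P e f" for f
    using that vtx by (auto simp: share_vertex_def)
  have C: "?C \<subseteq> {f \<in> edges P. f \<noteq> e \<and> \<not> share_vertex P e f \<and> in_common_two_face P e f}"
    using notshare
    by (auto simp: disjoint_edges_def in_common_two_face_def faces_up_def)
  have AB: "?A \<inter> ?B = {}"
  proof (rule ccontr)
    assume "?A \<inter> ?B \<noteq> {}"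
    then obtain a b where "closed_segment u a = closed_segment v b" "a \<noteq> v"
      by (auto simp: free_nbrs_def)
    then have "{u, a} = {v, b}" using vertices_segment by metis
    then show False using \<open>a \<noteq> v\<close> adj_neq[OF uv] by (auto simp: doubleton_eq_iff)
  qed
  have finA: "finite ?A" "finite ?B" "finite ?C"
    by (rule finite_subset[OF _ fin]; use A B C in blast)+
  have cA: "card ?A = card (free_nbrs P u v)" "card ?B = card (free_nbrs P v u)"
    by (auto intro: card_image inj_on_segment)
  have cC: "card ?C = (\<Sum>F\<in>faces_up P e. card (disjoint_edges P e F))"
  proof (rule card_UN_disjoint[OF finite_faces_up[OF P]])
    show "\<forall>F\<in>faces_up P e. finite (disjoint_edges P e F)"
      using fin by (auto simp: disjoint_edges_def)
    show "\<forall>F\<in>faces_up P e. \<forall>G\<in>faces_up P e. F \<noteq> G \<longrightarrow> disjoint_edges P e F \<inter> disjoint_edges P e G = {}"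
    proof (intro ballI impI, rule ccontr)
      fix F G assume h: "F \<in> faces_up P e" "G \<in> faces_up P e" "F \<noteq> G"
        "disjoint_edges P e F \<inter> disjoint_edges P e G \<noteq> {}"
      \<comment> \<open>An edge counted in two 2-faces would lie in their intersection
        \<open>e\<close> and so share a vertex with it.\<close>
      then obtain f where f: "f \<in> edges P" "f \<subseteq> F \<inter> G" "\<not> share_vertex P e f"
        by (auto simp: disjoint_edges_def)
      have "f \<subseteq> e" using two_faces_Int[OF uv] h f e_def by blast
      moreover obtain a b where "f = closed_segment a b" "adj P a b"
        using edge_eq_segment[OF P f(1)] by blast
      ultimately have "a \<in> vertices P" "a \<in> e" "a \<in> f" using adj_vertex by auto
      then show False using f by (auto simp: share_vertex_def)
    qed
  qed
  have "card (?A \<union> ?B \<union> ?C) = card ?A + card ?B + card ?C"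
  proof -
    have "(?A \<union> ?B) \<inter> ?C = {}" using A B C by blast
    then show ?thesis using finA AB by (simp add: card_Un_disjoint)
  qed
  moreover have "card (?A \<union> ?B \<union> ?C) \<le> card (parallel_neighbors P e)"
  proof (rule card_mono)
    show "finite (parallel_neighbors P e)" using fin by (auto simp: parallel_neighbors_def)
    show "?A \<union> ?B \<union> ?C \<subseteq> parallel_neighbors P e"
      using A B C unfolding parallel_neighbors_def by blast
  qed
  ultimately show ?thesis using cA cC by simp
qed

text \<open>A discrete intermediate value theorem for paths.\<close>

lemma rtranclp_crosses_level:
  fixes \<phi> :: "'a \<Rightarrow> int"
  assumes "R\<^sup>*\<^sup>* x y" "\<phi> x \<le> j" "j < \<phi> y"
  shows "\<exists>a b. R a b \<and> \<phi> a \<le> j \<and> j < \<phi> b"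
  using assms
proof (induction rule: rtranclp_induct)
  case (step y z)
  then show ?case by (cases "j < \<phi> y") (blast, force simp: not_less)
qed simp

text \<open>Every level between \<open>\<phi> w\<close> and \<open>\<phi> w'\<close> is crossed by an edge off \<open>e\<close>; as \<open>\<phi>\<close> is 1-Lipschitz, an edge
  crosses only the level given by the minimum of \<open>\<phi>\<close> on it.\<close>

lemma opp_potential_diff:
  fixes P :: "'a::euclidean_space set" and \<phi> :: "'a \<Rightarrow> int"
  assumes P: "polytope P" and uv: "adj P u v" and F: "F \<in> faces_up P (closed_segment u v)"
    and lip: "\<And>x y. adj P x y \<Longrightarrow> \<phi> y \<le> \<phi> x + 1"
  shows "\<phi> (opp F v u) - \<phi> (opp F u v) \<le> int (card (disjoint_edges P (closed_segment u v) F))"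
proof -
  let ?e = "closed_segment u v"
  note FD = faces_upD[OF P uv F]
  have vu: "adj P v u" and F': "F \<in> faces_up P (closed_segment v u)"
    using adj_sym[OF uv] F by (simp_all add: closed_segment_commute)
  define w w' where "w = opp F u v" and "w' = opp F v u"
  have w: "adj F u w" "w \<noteq> v" and w': "adj F v w'" "w' \<noteq> u"
    using opp_props(1,2)[OF P uv F] opp_props(1,2)[OF P vu F'] by (auto simp: w_def w'_def)
  have wv: "w \<in> vertices F" "w' \<in> vertices F" using w w' adj_vertex2 by blast+
  have "w \<notin> ?e" "w' \<notin> ?e"
    using other_vertex_not_in_edge[OF FD(4)] wv w w' adj_neq by metis+
  then have conn: "(\<lambda>x y. adj F x y \<and> x \<notin> ?e \<and> y \<notin> ?e)\<^sup>*\<^sup>* w w'"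
    using connected_off_edge[OF FD(2,4)] wv by blast
  have "\<exists>f\<in>disjoint_edges P ?e F. Min (\<phi> ` vertices f) = j" if "j \<in> {\<phi> w..<\<phi> w'}" for j
  proof -
    obtain a b where ab: "adj F a b" "a \<notin> ?e" "b \<notin> ?e" "\<phi> a \<le> j" "j < \<phi> b"
      using rtranclp_crosses_level[OF conn, of \<phi> j] \<open>j \<in> _\<close> by auto
    have adj: "adj P a b" "closed_segment a b \<subseteq> F" using ab(1) adj_face[OF FD(1)] by auto
    have "\<phi> b \<le> \<phi> a + 1" using lip adj by blast
    then have "Min (\<phi> ` vertices (closed_segment a b)) = j"
      using ab by (simp add: vertices_segment)
    moreover have "\<not> share_vertex P ?e (closed_segment a b)"
    proof
      assume "share_vertex P ?e (closed_segment a b)"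
      then obtain z where "z \<in> vertices P" "z \<in> ?e" "z \<in> closed_segment a b"
        by (auto simp: share_vertex_def)
      then show False using other_vertex_not_in_edge[OF adj(1)] ab by blast
    qed
    ultimately show ?thesis
      using adj by (intro bexI[of _ "closed_segment a b"]) (simp_all add: disjoint_edges_def adj_edge)
  qed
  then have "{\<phi> w..<\<phi> w'} \<subseteq> (\<lambda>f. Min (\<phi> ` vertices f)) ` disjoint_edges P ?e F" by force
  moreover have fin: "finite (disjoint_edges P ?e F)"
    using finite_edges[OF P] by (simp add: disjoint_edges_def)
  ultimately have "card {\<phi> w..<\<phi> w'} \<le> card (disjoint_edges P ?e F)"
    by (metis surj_card_le)
  \<comment> \<open>The interval has \<open>nat (\<phi> w' - \<phi> w)\<close> elements, so a
    negative difference is covered as well.\<close>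
  then show ?thesis by (simp add: w_def w'_def)
qed

section \<open>Change of the Laplacian and of the degree along an edge\<close>

definition laplace :: "'a::euclidean_space set \<Rightarrow> ('a \<Rightarrow> int) \<Rightarrow> 'a \<Rightarrow> int" where
  "laplace P \<phi> v = (\<Sum>w\<in>nbrs P v. \<phi> w - \<phi> v)"

text \<open>In the difference of the Laplacians at \<open>v\<close> and \<open>u\<close>, the edge
  itself contributes -2, the free neighbours at most their number, and each 2-face at most its count
  of disjoint edges minus 1. The total is at most the number of parallel neighbours minus the number
  of 2-faces minus 2, hence at most -1 by positivity.\<close>

lemma laplace_step:
  fixes P :: "'a::euclidean_space set" and \<phi> :: "'a \<Rightarrow> int"
  assumes P: "polytope P" and pos: "forman_ricci_positive P" and uv: "adj P u v"
    and lip: "\<And>x y. adj P x y \<Longrightarrow> \<phi> y \<le> \<phi> x + 1" and up: "\<phi> v = \<phi> u + 1"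
  shows "laplace P \<phi> v \<le> laplace P \<phi> u - 1"
proof -
  let ?e = "closed_segment u v"
  let ?U = "faces_up P ?e"
  have vu: "adj P v u" and ec: "closed_segment v u = ?e"
    using adj_sym[OF uv] by (simp_all add: closed_segment_commute)
  have "forman_ricci P ?e > 0"
    using pos adj_edge[OF uv] by (auto simp: forman_ricci_positive_def)
  then have par: "int (card (parallel_neighbors P ?e)) \<le> int (card ?U) + 1"
    by (simp add: forman_ricci_def)
  have fu: "(\<Sum>w\<in>free_nbrs P u v. \<phi> w - \<phi> u) \<ge> - int (card (free_nbrs P u v))"
  proof -
    have "- 1 \<le> \<phi> w - \<phi> u" if "w \<in> free_nbrs P u v" for w
      using that lip[OF adj_sym[of P u w]] by (simp add: free_nbrs_def)
    then show ?thesis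
      using sum_bounded_below[of "free_nbrs P u v" "- 1" "\<lambda>w. \<phi> w - \<phi> u"] by simp
  qed
  have fv: "(\<Sum>w\<in>free_nbrs P v u. \<phi> w - \<phi> v) \<le> int (card (free_nbrs P v u))"
    using sum_bounded_above[of "free_nbrs P v u" "\<lambda>w. \<phi> w - \<phi> v" 1] lip
    by (force simp: free_nbrs_def)
  have "(\<Sum>F\<in>?U. \<phi> (opp F v u) - \<phi> (opp F u v)) \<le> (\<Sum>F\<in>?U. int (card (disjoint_edges P ?e F)))"
    by (rule sum_mono) (rule opp_potential_diff[OF P uv _ lip])
  \<comment> \<open>Measuring from \<open>\<phi> v\<close> at one end and from
    \<open>\<phi> u\<close> at the other costs 1 for each 2-face.\<close>
  moreover have "(\<Sum>F\<in>?U. \<phi> (opp F v u) - \<phi> (opp F u v))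
      = (\<Sum>F\<in>?U. \<phi> (opp F v u) - \<phi> v) - (\<Sum>F\<in>?U. \<phi> (opp F u v) - \<phi> u) + int (card ?U)"
    using up by (simp add: sum_subtractf algebra_simps)
  ultimately show ?thesis
    using sum_nbrs[OF P uv, of "\<lambda>w. \<phi> w - \<phi> u"] sum_nbrs[OF P vu, of "\<lambda>w. \<phi> w - \<phi> v"]
      card_parallel_neighbors_ge[OF P uv] par fu fv up
    unfolding laplace_def ec
    by (simp flip: of_nat_sum)
qed

text \<open>With \<open>m\<close> 2-faces through the edge, each end has degree \<open>m + 1\<close>
  plus its free neighbours. Positivity allows at most \<open>m + 1\<close> free neighbours at
  \<open>v\<close>, so its degree is at most \<open>2 * (m + 1)\<close>.\<close>

lemma card_nbrs_le_double:
  fixes P :: "'a::euclidean_space set"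
  assumes P: "polytope P" and pos: "forman_ricci_positive P" and uv: "adj P u v"
  shows "card (nbrs P v) \<le> 2 * card (nbrs P u)"
proof -
  let ?e = "closed_segment u v"
  let ?U = "faces_up P ?e"
  have vu: "adj P v u" and ec: "closed_segment v u = ?e"
    using adj_sym[OF uv] by (simp_all add: closed_segment_commute)
  have "forman_ricci P ?e > 0"
    using pos adj_edge[OF uv] by (auto simp: forman_ricci_positive_def)
  then have "int (card (parallel_neighbors P ?e)) \<le> int (card ?U) + 1"
    by (simp add: forman_ricci_def)
  then show ?thesis
    using sum_nbrs[OF P uv, of "\<lambda>w. 1"] sum_nbrs[OF P vu, of "\<lambda>w. 1"]
      card_parallel_neighbors_ge[OF P uv]
    unfolding ec by simp
qed

subsection \<open>Distances and the number of vertices\<close>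

definition gdist :: "'a::euclidean_space set \<Rightarrow> 'a \<Rightarrow> 'a \<Rightarrow> nat" where
  "gdist P a x = (LEAST n. (adj P ^^ n) a x)"

lemma gdist_relpow:
  fixes P :: "'a::euclidean_space set"
  assumes "polytope P" "a \<in> vertices P" "x \<in> vertices P"
  shows "(adj P ^^ gdist P a x) a x"
proof -
  obtain n where "(adj P ^^ n) a x"
    using graph_connected[OF assms] unfolding rtranclp_power by blast
  then show ?thesis unfolding gdist_def by (rule LeastI)
qed

lemma gdist_le: "(adj P ^^ n) a x \<Longrightarrow> gdist P a x \<le> n"
  unfolding gdist_def by (rule Least_le)

lemma gdist_adj:
  fixes P :: "'a::euclidean_space set"
  assumes "polytope P" "a \<in> vertices P" "adj P x y"
  shows "gdist P a y \<le> gdist P a x + 1"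
proof -
  have "(adj P ^^ Suc (gdist P a x)) a y"
    using gdist_relpow[OF assms(1,2) adj_vertex[OF assms(3)]] assms(3) by (rule relpowp_Suc_I)
  then show ?thesis using gdist_le by fastforce
qed

lemma gdist_Suc:
  fixes P :: "'a::euclidean_space set"
  assumes "polytope P" "a \<in> vertices P" "y \<in> vertices P" "gdist P a y = Suc n"
  obtains x where "adj P x y" "gdist P a x = n"
proof -
  have "(adj P ^^ Suc n) a y" using gdist_relpow[OF assms(1-3)] assms(4) by simp
  then obtain x where x: "(adj P ^^ n) a x" "adj P x y" by (rule relpowp_Suc_E)
  then have "gdist P a x = n"
    using gdist_le[OF x(1)] gdist_adj[OF assms(1,2) x(2)] assms(4) by simp
  then show thesis using that x by blast
qed

text \<open>Going out along a geodesic, the Laplacian of the distance from \<open>a\<close> loses at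
  least 1 per step, while it starts at no more than the degree of \<open>a\<close> and ends at no
  less than minus the degree of \<open>y\<close>.\<close>

lemma gdist_le_degrees:
  fixes P :: "'a::euclidean_space set"
  assumes P: "polytope P" and pos: "forman_ricci_positive P"
    and a: "a \<in> vertices P" and y: "y \<in> vertices P"
  shows "gdist P a y \<le> card (nbrs P a) + card (nbrs P y)"
proof -
  let ?\<phi> = "\<lambda>x. int (gdist P a x)"
  have lip: "?\<phi> y \<le> ?\<phi> x + 1" if "adj P x y" for x y
    using gdist_adj[OF P a that] by simp
  have "laplace P ?\<phi> y \<le> laplace P ?\<phi> a - int n" if "gdist P a y = n" "y \<in> vertices P" for n y
    using that
  proof (induction n arbitrary: y)
    case 0
    then have "y = a" using gdist_relpow[OF P a 0(2)] by simp
    then show ?case by simp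
  next
    case (Suc n)
    obtain x where x: "adj P x y" "gdist P a x = n" using gdist_Suc[OF P a] Suc.prems by metis
    have "laplace P ?\<phi> y \<le> laplace P ?\<phi> x - 1"
      using laplace_step[OF P pos x(1) lip] Suc.prems x by simp
    then show ?case using Suc.IH[OF x(2) adj_vertex[OF x(1)]] by simp
  qed
  then have "laplace P ?\<phi> y \<le> laplace P ?\<phi> a - ?\<phi> y" using y by blast
  moreover have "laplace P ?\<phi> a \<le> int (card (nbrs P a))"
  proof -
    have "?\<phi> w - ?\<phi> a \<le> 1" if "w \<in> nbrs P a" for w
      using that lip[of a w] by (simp add: nbrs_def)
    then show ?thesis
      using sum_bounded_above[of "nbrs P a" "\<lambda>w. ?\<phi> w - ?\<phi> a" 1] by (simp add: laplace_def)
  qed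
  moreover have "laplace P ?\<phi> y \<ge> - int (card (nbrs P y))"
  proof -
    have "- 1 \<le> ?\<phi> w - ?\<phi> y" if "w \<in> nbrs P y" for w
      using that lip[OF adj_sym[of P y w]] by (simp add: nbrs_def)
    then show ?thesis
      using sum_bounded_below[of "nbrs P y" "- 1" "\<lambda>w. ?\<phi> w - ?\<phi> y"] by (simp add: laplace_def)
  qed
  ultimately show ?thesis by linarith
qed

section \<open>Counting walks through vertices of bounded degree\<close>

text \<open>Only the vertices that a walk leaves have to obey the degree bound, not its last one; so
  each step multiplies the count by at most \<open>B\<close>.\<close>

primrec walk_ends :: "('a \<Rightarrow> 'a set) \<Rightarrow> real \<Rightarrow> 'a \<Rightarrow> nat \<Rightarrow> 'a set" where
  "walk_ends N B a 0 = {a}"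
| "walk_ends N B a (Suc i) = (\<Union>x\<in>{x \<in> walk_ends N B a i. real (card (N x)) \<le> B}. N x)"

lemma finite_walk_ends:
  assumes "\<And>x. finite (N x)"
  shows "finite (walk_ends N B a i)"
  using assms by (induction i) auto

lemma card_walk_ends:
  assumes fin: "\<And>x. finite (N x)" and B: "B \<ge> 0"
  shows "real (card (walk_ends N B a i)) \<le> B ^ i"
proof (induction i)
  case (Suc i)
  let ?X = "{x \<in> walk_ends N B a i. real (card (N x)) \<le> B}"
  have fX: "finite ?X" using finite_walk_ends[of N B a i] fin by simp
  have "real (card (walk_ends N B a (Suc i))) \<le> (\<Sum>x\<in>?X. real (card (N x)))"
    using card_UN_le[OF fX, of N] by (simp flip: of_nat_sum)
  also have "\<dots> \<le> real (card ?X) * B"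
    by (rule sum_bounded_above) simp
  also have "\<dots> \<le> real (card (walk_ends N B a i)) * B"
    using B card_mono[OF finite_walk_ends[of N B a i], of ?X] fin by (intro mult_right_mono) auto
  also have "\<dots> \<le> B ^ i * B"
    using Suc B by (rule mult_right_mono)
  finally show ?case by (simp add: mult.commute)
qed simp

lemma degree_on_walk:
  fixes P :: "'a::euclidean_space set"
  assumes P: "polytope P" and pos: "forman_ricci_positive P"
    and f: "\<And>i. i < L \<Longrightarrow> adj P (f i) (f (Suc i))" and i: "i \<le> L"
  shows "card (nbrs P (f i)) \<le> 2 ^ i * card (nbrs P (f 0))"
    and "card (nbrs P (f i)) \<le> 2 ^ (L - i) * card (nbrs P (f L))"
proof -
  show "card (nbrs P (f i)) \<le> 2 ^ i * card (nbrs P (f 0))"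
    using i
  proof (induction i)
    case (Suc i)
    then show ?case using card_nbrs_le_double[OF P pos f[of i]] by simp
  qed simp
  show "card (nbrs P (f i)) \<le> 2 ^ (L - i) * card (nbrs P (f L))"
    using i
  proof (induction i rule: inc_induct)
    case (step i)
    then have "card (nbrs P (f i)) \<le> 2 * card (nbrs P (f (Suc i)))"
      using card_nbrs_le_double[OF P pos adj_sym[OF f[of i]]] by simp
    also have "\<dots> \<le> 2 * (2 ^ (L - Suc i) * card (nbrs P (f L)))" using step by simp
    also have "\<dots> = 2 ^ (L - i) * card (nbrs P (f L))"
      using step by (simp add: Suc_diff_Suc flip: power_Suc)
    finally show ?case .
  qed simp
qed

text \<open>Multiplying the doubling bounds from the two ends of a geodesic of length \<open>L\<close> bounds the squared
  degree of every vertex on it by \<open>2\<^sup>L k\<^sup>2\<close>.\<close>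

lemma low_degree_in_walk_ends:
  fixes P :: "'a::euclidean_space set" and k :: real
  assumes P: "polytope P" and pos: "forman_ricci_positive P"
    and a: "a \<in> vertices P" and y: "y \<in> vertices P"
    and low: "real (card (nbrs P a)) \<le> k" "real (card (nbrs P y)) \<le> k"
  shows "y \<in> walk_ends (nbrs P) (2 powr k * k) a (gdist P a y)"
proof -
  let ?L = "gdist P a y"
  let ?B = "2 powr k * k"
  have k: "k \<ge> 0" using low(1) by (meson of_nat_0_le_iff order_trans)
  have L: "real ?L \<le> 2 * k" using gdist_le_degrees[OF P pos a y] low by linarith
  obtain f where f: "f 0 = a" "f ?L = y" "\<And>i. i < ?L \<Longrightarrow> adj P (f i) (f (Suc i))"
    using gdist_relpow[OF P a y] by (auto simp: relpowp_fun_conv)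
  have deg: "real (card (nbrs P (f i))) \<le> ?B" if i: "i \<le> ?L" for i
  proof -
    let ?d = "real (card (nbrs P (f i)))"
    have "?d \<le> real (2 ^ i * card (nbrs P a))" "?d \<le> real (2 ^ (?L - i) * card (nbrs P y))"
      using degree_on_walk[where f = f, OF P pos f(3) i] f(1,2) by (simp_all only: of_nat_le_iff)
    then have "?d \<le> 2 ^ i * real (card (nbrs P a))" "?d \<le> 2 ^ (?L - i) * real (card (nbrs P y))"
      by simp_all
    then have "?d \<le> 2 ^ i * k" "?d \<le> 2 ^ (?L - i) * k"
      using low by (meson mult_left_mono order_trans zero_le_power zero_le_numeral)+
    then have "?d * ?d \<le> (2 ^ i * k) * (2 ^ (?L - i) * k)"
      using k by (intro mult_mono) auto
    also have "\<dots> = 2 ^ ?L * (k * k)"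
      using i by (simp add: algebra_simps flip: power_add)
    also have "\<dots> = 2 powr real ?L * (k * k)" by (simp add: powr_realpow)
    \<comment> \<open>The low degrees of both ends limit the length to \<open>2 * k\<close>, which
      turns the bound into the square of \<open>?B\<close>.\<close>
    also have "\<dots> \<le> 2 powr (2 * k) * (k * k)"
      using L k by (intro mult_right_mono) auto
    also have "2 powr (2 * k) = 2 powr k * 2 powr k"
      unfolding mult_2 by (rule powr_add)
    also have "2 powr k * 2 powr k * (k * k) = ?B * ?B" by (simp only: mult_ac)
    finally have "?d\<^sup>2 \<le> ?B\<^sup>2" unfolding power2_eq_square .
    then show ?thesis by (rule power2_le_imp_le) (use k in simp)
  qed
  have "f i \<in> walk_ends (nbrs P) ?B a i" if "i \<le> ?L" for i
    using that
  proof (induction i)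
    case (Suc i)
    have i: "i \<le> ?L" "i < ?L" using Suc.prems by auto
    have "f i \<in> {x \<in> walk_ends (nbrs P) ?B a i. real (card (nbrs P x)) \<le> ?B}"
      using Suc.IH[OF i(1)] deg[OF i(1)] by blast
    moreover have "f (Suc i) \<in> nbrs P (f i)"
      unfolding nbrs_def using f(3)[OF i(2)] by blast
    ultimately show ?case unfolding walk_ends.simps by (rule UN_I)
  qed (simp add: f)
  from this[OF order_refl] show ?thesis unfolding f(2) .
qed

lemma geometric_sum_le:
  fixes B :: real
  assumes "B \<ge> 2"
  shows "(\<Sum>i\<le>N. B ^ i) \<le> 2 * B ^ N"
proof (induction N)
  case (Suc N)
  have "2 * B ^ N \<le> B * B ^ N" using assms by (intro mult_right_mono) auto
  then show ?case using Suc by simp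
qed simp

text \<open>Fix one low-degree vertex. All others are reached from it by controlled walks of length
  at most \<open>2 * k\<close>, and the numbers of ends are summed as a geometric series.\<close>

lemma card_low_degree_vertices_le:
  fixes P :: "'a::euclidean_space set" and k :: real
  assumes P: "polytope P" and pos: "forman_ricci_positive P" and k: "k \<ge> 1"
  shows "real (card {v \<in> vertices P. real (card (nbrs P v)) \<le> k})
    \<le> 2 * (2 powr k * k) powr (2 * k)"
proof (cases "{v \<in> vertices P. real (card (nbrs P v)) \<le> k} = {}")
  case False
  let ?S = "{v \<in> vertices P. real (card (nbrs P v)) \<le> k}"
  let ?B = "2 powr k * k"
  let ?N = "nat \<lfloor>2 * k\<rfloor>"
  let ?W = "walk_ends (nbrs P) ?B"
  obtain a where a: "a \<in> vertices P" "real (card (nbrs P a)) \<le> k" using False by blast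
  have "2 powr k \<ge> (2 powr 1 :: real)" using k by (intro powr_mono) auto
  then have B: "?B \<ge> 2" using k mult_mono[of 2 "2 powr k" 1 k] by simp
  have fin: "finite (nbrs P x)" for x by (rule finite_nbrs[OF P])
  have "?S \<subseteq> (\<Union>i\<le>?N. ?W a i)"
  proof
    fix y assume "y \<in> ?S"
    then have y: "y \<in> vertices P" "real (card (nbrs P y)) \<le> k" by auto
    have "gdist P a y \<le> ?N"
      using gdist_le_degrees[OF P pos a(1) y(1)] a y by (simp add: le_nat_floor)
    then show "y \<in> (\<Union>i\<le>?N. ?W a i)"
      using low_degree_in_walk_ends[OF P pos a(1) y(1) a(2) y(2)] by blast
  qed
  then have "card ?S \<le> card (\<Union>i\<le>?N. ?W a i)"
    using finite_walk_ends[of "nbrs P"] fin by (intro card_mono) auto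
  also have "\<dots> \<le> (\<Sum>i\<le>?N. card (?W a i))"
    by (rule card_UN_le) simp
  finally have "real (card ?S) \<le> (\<Sum>i\<le>?N. real (card (?W a i)))"
    by (simp flip: of_nat_sum)
  also have "\<dots> \<le> (\<Sum>i\<le>?N. ?B ^ i)"
    using card_walk_ends[of "nbrs P" ?B] fin B by (intro sum_mono) auto
  also have "\<dots> \<le> 2 * ?B ^ ?N"
    by (rule geometric_sum_le[OF B])
  also have "?B ^ ?N = ?B powr real ?N"
    using B by (intro powr_realpow[symmetric]) simp
  also have "\<dots> \<le> ?B powr (2 * k)"
    using B k by (intro powr_mono) (auto simp: of_nat_floor)
  finally show ?thesis by simp
next
  case True
  then show ?thesis by (metis card.empty of_nat_0 mult_nonneg_nonneg powr_ge_zero zero_le_numeral)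
qed

section \<open>Averaging and the final estimate\<close>

text \<open>Markov's inequality: if more than half of the values exceeded twice the mean, they alone
  would exceed the total.\<close>

lemma card_le_double_card_low:
  fixes g :: "'a \<Rightarrow> real" and \<rho> :: real
  assumes "finite V" "\<And>v. v \<in> V \<Longrightarrow> g v \<ge> 0" "(\<Sum>v\<in>V. g v) \<le> \<rho> * card V" "\<rho> > 0"
  shows "real (card V) \<le> 2 * real (card {v \<in> V. g v \<le> 2 * \<rho>})"
proof -
  let ?H = "{v \<in> V. \<not> g v \<le> 2 * \<rho>}" and ?S = "{v \<in> V. g v \<le> 2 * \<rho>}"
  have "real (card ?H) * (2 * \<rho>) \<le> (\<Sum>v\<in>?H. g v)"
    by (rule sum_bounded_below) auto
  also have "\<dots> \<le> (\<Sum>v\<in>V. g v)"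
    using assms by (intro sum_mono2) auto
  finally have "(2 * real (card ?H)) * \<rho> \<le> real (card V) * \<rho>"
    using assms(3) by (simp add: algebra_simps)
  then have "2 * real (card ?H) \<le> real (card V)"
    using assms(4) by simp
  moreover have "card V = card ?S + card ?H"
    using assms(1) by (subst card_Un_disjoint[symmetric]) (auto intro: arg_cong[of _ _ card])
  ultimately show ?thesis by simp
qed

text \<open>Since \<open>A - 1 \<ge> B\<close>, the power \<open>X\<close> dominates
  \<open>2 * B powr (4 * \<rho>)\<close>, the factor 2 being absorbed by one extra power of
  \<open>B\<close>. The quotient on the right is at least \<open>2 * X\<close>.\<close>

lemma vertex_bound_le:
  fixes \<rho> :: real
  assumes "\<rho> \<ge> 1"
  shows "4 * (2 powr (2 * \<rho>) * (2 * \<rho>)) powr (4 * \<rho>) \<le>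
    ((2 powr (3 * \<rho> + 1) * \<rho>) * (2 powr (3 * \<rho> + 1) * \<rho> - 1) powr (4 + 6 * \<rho>) - 2)
      / (2 powr (3 * \<rho>) * \<rho> - 1)"
proof -
  define B where "B = 2 powr (2 * \<rho>) * (2 * \<rho>)"
  define A where "A = 2 powr (3 * \<rho> + 1) * \<rho>"
  define X where "X = (A - 1) powr (4 + 6 * \<rho>)"
  have p2: "2 powr (2 * \<rho>) \<ge> 1" and p1: "2 powr \<rho> \<ge> (2::real)"
    using assms powr_mono[of 1 \<rho> 2] by (auto intro: ge_one_powr_ge_zero)
  have B: "B \<ge> 2"
    using mult_mono[OF p2, of 2 "2 * \<rho>"] assms by (simp add: B_def)
  have "3 * \<rho> + 1 = \<rho> + 2 * \<rho> + 1" by simp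
  then have "A = 2 powr \<rho> * B"
    unfolding A_def B_def by (simp only: powr_add) simp
  then have A: "A \<ge> 2 * B" using mult_right_mono[OF p1, of B] B by simp
  have half: "2 powr (3 * \<rho>) * \<rho> = A / 2" by (simp add: A_def powr_add)
  have "2 * B powr (4 * \<rho>) \<le> B powr 1 * B powr (4 * \<rho>)" using B by (intro mult_right_mono) auto
  also have "\<dots> = B powr (1 + 4 * \<rho>)" by (rule powr_add[symmetric])
  also have "\<dots> \<le> B powr (4 + 6 * \<rho>)" using B assms by (intro powr_mono) auto
  also have "\<dots> \<le> X" unfolding X_def using A B assms by (intro powr_mono2) auto
  finally have BX: "4 * B powr (4 * \<rho>) \<le> 2 * X" by simp
  have "X \<ge> 1" unfolding X_def using A B assms by (intro ge_one_powr_ge_zero) auto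
  \<comment> \<open>Clearing the positive denominator reduces this to
    \<open>X \<ge> 1\<close>.\<close>
  then have "2 * X \<le> (A * X - 2) / (A / 2 - 1)"
    using A B by (simp add: pos_le_divide_eq algebra_simps)
  then show ?thesis
    using BX unfolding half B_def[symmetric] A_def[symmetric] X_def[symmetric] by linarith
qed

theorem theorem2p5:
  fixes P :: "'a::euclidean_space set" and d n :: nat and \<rho> :: real
  assumes "polytope P"
    and "aff_dim P = int d"
    and "forman_ricci_positive P"
    and "\<rho> = average_degree P"
    and "n = card (vertices P)"
  shows "real n \<le>
    ((2 powr (3 * \<rho> + 1) * \<rho>) * (2 powr (3 * \<rho> + 1) * \<rho> - 1) powr (4 + 6 * \<rho>) - 2)
      / (2 powr (3 * \<rho>) * \<rho> - 1)"
proof (cases "d = 0")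
  case True
  then obtain p where p: "P = {p}" using assms(2) by (auto simp: aff_dim_eq_0)
  then have V: "vertices P = {p}" by (auto simp: vertices_def)
  have "nbrs P p = {}"
    using adj_neq adj_vertex2 V by (fastforce simp: nbrs_def)
  then have "vertex_degree P p = 0"
    using vertex_degree_eq[OF assms(1), of p] V by simp
  then have "\<rho> = 0" using assms(4) V by (simp add: average_degree_def)
  \<comment> \<open>At \<rho> = 0 the product containing \<open>powr\<close> vanishes, and the bound
    becomes (-2)/(-1) = 2.\<close>
  then show ?thesis using assms(5) V by simp
next
  case False
  note P = assms(1) and fin = finite_vertices[OF assms(1)]
  have deg: "vertex_degree P v \<ge> 1" if v: "v \<in> vertices P" for v
  proof -
    have "P \<noteq> {v}" using assms(2) False by auto
    then obtain x where x: "x \<in> P" "x \<noteq> v" using v vertices_subset by blast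
    \<comment> \<open>The functional \<open>x - v\<close> grows from \<open>v\<close> to
      \<open>x\<close>, so \<open>v\<close> has an improving neighbour.\<close>
    then have "(x - v) \<bullet> x > (x - v) \<bullet> v"
      using inner_gt_zero_iff[of "x - v"] by (simp add: inner_diff_right)
    then obtain w where "adj P v w" using improving_neighbour[OF P v x(1)] by blast
    then have "nbrs P v \<noteq> {}" by (auto simp: nbrs_def)
    then show ?thesis
      using vertex_degree_eq[OF P v] finite_nbrs[OF P, of v] by (simp add: Suc_le_eq card_gt_0_iff)
  qed
  have "P \<noteq> {}" using assms(2) by auto
  then have "vertices P \<noteq> {}" using polytope_eq_hull_vertices[OF P] by auto
  then have n: "n > 0" using fin assms(5) by (simp add: card_gt_0_iff)
  have sum: "(\<Sum>v\<in>vertices P. real (card (nbrs P v))) = \<rho> * card (vertices P)"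
    using n assms(4,5) vertex_degree_eq[OF P] by (simp add: average_degree_def)
  have "real n \<le> (\<Sum>v\<in>vertices P. real (vertex_degree P v))"
    using sum_bounded_below[of "vertices P" 1 "\<lambda>v. real (vertex_degree P v)"] deg assms(5) by simp
  then have \<rho>: "\<rho> \<ge> 1"
    using n assms(4,5) by (simp add: average_degree_def)
  have "real n \<le> 2 * real (card {v \<in> vertices P. real (card (nbrs P v)) \<le> 2 * \<rho>})"
    using card_le_double_card_low[OF fin, of "\<lambda>v. real (card (nbrs P v))" \<rho>] sum \<rho> assms(5) by simp
  also have "\<dots> \<le> 2 * (2 * (2 powr (2 * \<rho>) * (2 * \<rho>)) powr (2 * (2 * \<rho>)))"
    using card_low_degree_vertices_le[OF P assms(3), of "2 * \<rho>"] \<rho> by simp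
  also have "\<dots> = 4 * (2 powr (2 * \<rho>) * (2 * \<rho>)) powr (4 * \<rho>)" by simp
  also have "\<dots> \<le> ((2 powr (3 * \<rho> + 1) * \<rho>) * (2 powr (3 * \<rho> + 1) * \<rho> - 1) powr (4 + 6 * \<rho>) - 2)
      / (2 powr (3 * \<rho>) * \<rho> - 1)"
    by (rule vertex_bound_le[OF \<rho>])
  finally show ?thesis .
qed

end
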